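(* Let $j\geq 2$ and $n\geq j$ be integers. Then there is an isomorphism of abelian groups $$\mathrm{Coker}(A_{C_n^j}-I_n)\cong \mathrm{Coker}(M_j^n-I_j).$$
   Context: For positive integers $n$ and $j$, $C_n^j$ denotes the directed graph with $n$ vertices $v_1,\dots,v_n$ and $2n$ edges $e_1,\dots,e_n,f_1,\dots,f_n$, where $e_i$ goes from $v_i$ to $v_{i+1}$ and $f_i$ goes from $v_i$ to $v_{i+j}$, with indices interpreted modulo $n$. For a finite directed graph $E$ with vertices $v_1,\dots,v_n$, the incidence matrix $A_E$ is the $n\times n$ matrix whose $(k,\ell)$ entry is the number of edges with source $v_k$ and range $v_\ell$. $I_m$ is the $m\times m$ identity matrix. For a square integer matrix $M$ of size $m$, $\mathrm{Coker}(M)=\mathbb{Z}^m/M\mathbb{Z}^m$, where $M$ acts by left multiplication on column vectors. For $j\geq 2$, $M_j$ is the $j\times j$ companion matrix of $p_j(x)=x^j-x^{j-1}-1$, i.e. the matrix with entries $(M_j)_{i+1,i}=1$ for $1\le i\le j-1$, with last column having $1$ in row $1$, $1$ in row $j$ and $0$ in all other rows, and all remaining entries equal to $0$: $$M_j=\begin{bmatrix}0&0&\cdots&0&1\\1&0&\cdots&0&0\\0&1&\cdots&0&0\\ \vdots&&\ddots&&\vdots\\0&0&\cdots&1&1\end{bmatrix}.$$ *)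

theory Defs
  imports
    "HOL-Algebra.Coset"
    "Graph_Theory.Digraph"
    "Jordan_Normal_Form.Matrix"
begin

text \<open>Each constructor carries the index of its edge, so parallel edges and loops
  (for instance \<open>f_i\<close> when \<open>n\<close> divides \<open>j\<close>) are all counted.\<close>

datatype edge = E nat | F nat

text \<open>Indices are residues modulo \<open>n\<close>, represented by \<open>0, \<dots>, n - 1\<close> instead of
  \<open>1, \<dots>, n\<close>, in line with the 0-based indexing of matrices: the number \<open>i\<close> stands for
  \<open>v_(i+1)\<close>, and \<open>E i\<close>, \<open>F i\<close> for \<open>e_(i+1)\<close>, \<open>f_(i+1)\<close>.\<close>

definition circ_graph :: "nat \<Rightarrow> nat \<Rightarrow> (nat, edge) pre_digraph" where
  "circ_graph n j = \<lparr>
     verts = {0..<n},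
     arcs = E ` {0..<n} \<union> F ` {0..<n},
     tail = (\<lambda>a. case a of E i \<Rightarrow> i | F i \<Rightarrow> i),
     head = (\<lambda>a. case a of E i \<Rightarrow> (i + 1) mod n | F i \<Rightarrow> (i + j) mod n)\<rparr>"

text \<open>The list \<open>vs\<close> is the chosen enumeration of the vertices of \<open>G\<close>.\<close>

definition incidence_mat :: "'a list \<Rightarrow> ('a, 'b) pre_digraph \<Rightarrow> int mat" where
  "incidence_mat vs G = mat (length vs) (length vs)
     (\<lambda>(k, l). int (card {a \<in> arcs G. tail G a = vs ! k \<and> head G a = vs ! l}))"

definition coker :: "int mat \<Rightarrow> int vec set monoid" where
  "coker M = monoid_vec TYPE(int) (dim_row M) Mod ((\<lambda>x. M *\<^sub>v x) ` carrier_vec (dim_col M))"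

text \<open>Companion matrix of \<open>x^j - x^(j-1) - 1\<close>, meant for \<open>j \<ge> 2\<close> only.\<close>

definition companion_M :: "nat \<Rightarrow> int mat" where
  "companion_M j = mat j j (\<lambda>(r, c).
     if c = j - 1 then (if r = 0 \<or> r = j - 1 then 1 else 0)
     else (if r = c + 1 then 1 else 0))"

lemma fin_digraph_circ_graph: "fin_digraph (circ_graph n j)"
  by unfold_locales (auto simp: circ_graph_def)

lemma distinct_verts_circ_graph: "distinct [0..<n]" "set [0..<n] = verts (circ_graph n j)"
  by (simp_all add: circ_graph_def)

lemma card_arcs_circ_graph: "card (arcs (circ_graph n j)) = 2 * n"
  unfolding circ_graph_def
  by (simp, subst card_Un_disjoint) (auto simp: card_image inj_on_def)

lemma companion_M_4: "companion_M 4 = mat_of_rows_list 4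
  [[0, 0, 0, 1],
   [1, 0, 0, 0],
   [0, 1, 0, 0],
   [0, 0, 1, 1]]"
  by (rule eq_matI)
    (auto simp: companion_M_def mat_of_rows_list_def less_Suc_eq numeral_eq_Suc)

lemma comm_group_coker: "comm_group (coker M)"
proof -
  let ?G = "monoid_vec TYPE(int) (dim_row M)"
  let ?H = "(\<lambda>x. M *\<^sub>v x) ` carrier_vec (dim_col M)"
  interpret G: comm_group ?G by (rule comm_group_vec)
  have M: "M \<in> carrier_mat (dim_row M) (dim_col M)" by simp
  have inv: "inv\<^bsub>?G\<^esub> y = - y" if "y \<in> carrier_vec (dim_row M)" for y
    by (rule G.inv_equality) (use that in \<open>auto simp: monoid_vec_simps\<close>)
  have "subgroup ?H ?G"
  proof (rule G.subgroupI)
    show "?H \<subseteq> carrier ?G" using M by (auto simp: monoid_vec_simps intro!: mult_mat_vec_carrier)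
    show "?H \<noteq> {}" using zero_carrier_vec by blast
  next
    fix a assume "a \<in> ?H"
    then obtain x where x: "x \<in> carrier_vec (dim_col M)" "a = M *\<^sub>v x" by auto
    have "inv\<^bsub>?G\<^esub> a = - a" by (rule inv) (use x mult_mat_vec_carrier[OF M] in auto)
    also have "- a = M *\<^sub>v (- x)"
      using x by (auto intro!: eq_vecI)
    finally show "inv\<^bsub>?G\<^esub> a \<in> ?H" using x by auto
  next
    fix a b assume "a \<in> ?H" "b \<in> ?H"
    then obtain x y where xy: "x \<in> carrier_vec (dim_col M)" "a = M *\<^sub>v x"
        "y \<in> carrier_vec (dim_col M)" "b = M *\<^sub>v y" by auto
    have "a + b = M *\<^sub>v (x + y)" using xy mult_add_distrib_mat_vec[OF M] by simp
    then show "a \<otimes>\<^bsub>?G\<^esub> b \<in> ?H" using xy by (auto simp: monoid_vec_simps)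
  qed
  then show ?thesis unfolding coker_def by (rule G.abelian_FactGroup)
qed

end

theory Submission
  imports Defs
begin

text \<open>With \<open>B = A - I\<close> one has \<open>B e_l = e_(l-1) + e_(l-j) - e_l\<close> (indices modulo \<open>n\<close>), so
  the generators of the cokernel of \<open>B\<close> satisfy the same recurrence
  \<open>e_l = e_(l-1) + e_(l-j)\<close> as the orbit \<open>M^l e_0\<close> of the companion matrix \<open>M\<close>. Hence
  \<open>P: e_l \<mapsto> M^l e_0\<close> and \<open>Q: e_c \<mapsto> e_c\<close> (\<open>c < j\<close>) induce mutually inverse maps of the
  cokernels. The key point for \<open>Q\<close> is that it intertwines \<open>M\<close> with the cyclic shift modulo the
  range of \<open>B\<close>; the \<open>n\<close>-th power of the shift is the identity, so \<open>Q\<close> maps the range of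
  \<open>M^n - I\<close> into that of \<open>B\<close>.\<close>

section \<open>Ranges of integer matrices as subgroups, and their cokernels\<close>

definition mat_range :: "int mat \<Rightarrow> int vec set" where
  "mat_range M = (\<lambda>x. M *\<^sub>v x) ` carrier_vec (dim_col M)"

lemma mat_rangeI: "M \<in> carrier_mat m k \<Longrightarrow> x \<in> carrier_vec k \<Longrightarrow> M *\<^sub>v x \<in> mat_range M"
  by (auto simp: mat_range_def)

lemma mat_rangeE:
  assumes "y \<in> mat_range M" "M \<in> carrier_mat m k"
  obtains x where "x \<in> carrier_vec k" "y = M *\<^sub>v x"
  using assms by (auto simp: mat_range_def)

lemma mat_range_carrier: "M \<in> carrier_mat m k \<Longrightarrow> mat_range M \<subseteq> carrier_vec m"
  by (auto simp: mat_range_def)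

lemma mat_range_add:
  assumes M: "M \<in> carrier_mat m k" and "a \<in> mat_range M" "b \<in> mat_range M"
  shows "a + b \<in> mat_range M"
proof -
  obtain x y where "x \<in> carrier_vec k" "a = M *\<^sub>v x" "y \<in> carrier_vec k" "b = M *\<^sub>v y"
    using assms by (metis mat_rangeE)
  then show ?thesis
    using mult_add_distrib_mat_vec[OF M] mat_rangeI[OF M, of "x + y"] by auto
qed

lemma mat_range_diff:
  assumes M: "M \<in> carrier_mat m k" and "a \<in> mat_range M" "b \<in> mat_range M"
  shows "a - b \<in> mat_range M"
proof -
  obtain x y where "x \<in> carrier_vec k" "a = M *\<^sub>v x" "y \<in> carrier_vec k" "b = M *\<^sub>v y"
    using assms by (metis mat_rangeE)
  then show ?thesis
    using mult_minus_distrib_mat_vec[OF M] mat_rangeI[OF M, of "x - y"] by auto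
qed

lemma mat_range_zero: "M \<in> carrier_mat m k \<Longrightarrow> 0\<^sub>v m \<in> mat_range M"
  unfolding mat_range_def by (rule image_eqI[of _ _ "0\<^sub>v k"]) auto

lemma coker_eq: "M \<in> carrier_mat m k \<Longrightarrow> coker M = monoid_vec TYPE(int) m Mod mat_range M"
  by (auto simp: coker_def mat_range_def)

lemma normal_mat_range:
  assumes M: "M \<in> carrier_mat m k"
  shows "mat_range M \<lhd> monoid_vec TYPE(int) m"
proof -
  let ?G = "monoid_vec TYPE(int) m"
  interpret G: comm_group ?G by (rule comm_group_vec)
  have "subgroup (mat_range M) ?G"
  proof (rule G.subgroupI)
    show "mat_range M \<subseteq> carrier ?G"
      using mat_range_carrier[OF M] by (simp add: monoid_vec_simps)
    show "mat_range M \<noteq> {}" using mat_range_zero[OF M] by auto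
  next
    fix a assume a: "a \<in> mat_range M"
    then have "a \<in> carrier_vec m" using mat_range_carrier[OF M] by auto
    then have "inv\<^bsub>?G\<^esub> a = 0\<^sub>v m - a"
      by (intro G.inv_equality) (auto simp: monoid_vec_simps)
    then show "inv\<^bsub>?G\<^esub> a \<in> mat_range M"
      using mat_range_diff[OF M mat_range_zero[OF M] a] by simp
  next
    fix a b assume "a \<in> mat_range M" "b \<in> mat_range M"
    then show "a \<otimes>\<^bsub>?G\<^esub> b \<in> mat_range M"
      using mat_range_add[OF M] by (simp add: monoid_vec_simps)
  qed
  then show ?thesis by (rule G.subgroup_imp_normal)
qed

text \<open>First isomorphism theorem for \<open>P\<close> followed by the projection modulo the
  range of \<open>D\<close>. By \<open>PQ\<close> every class is hit, namely by \<open>Q\<close> of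
  a representative. The kernel is exactly the range of \<open>B\<close>: one inclusion is
  \<open>PB\<close>, the other combines \<open>QD\<close> and \<open>QP\<close>. All four conditions
  are stated on vectors, so no quotient appears when they are checked.\<close>

lemma coker_iso:
  assumes B: "B \<in> carrier_mat n n'" and D: "D \<in> carrier_mat m m'"
    and P: "P \<in> carrier_mat m n" and Q: "Q \<in> carrier_mat n m"
    and PB: "\<And>x. x \<in> mat_range B \<Longrightarrow> P *\<^sub>v x \<in> mat_range D"
    and QD: "\<And>y. y \<in> mat_range D \<Longrightarrow> Q *\<^sub>v y \<in> mat_range B"
    and PQ: "\<And>y. y \<in> carrier_vec m \<Longrightarrow> P *\<^sub>v (Q *\<^sub>v y) - y \<in> mat_range D"
    and QP: "\<And>x. x \<in> carrier_vec n \<Longrightarrow> Q *\<^sub>v (P *\<^sub>v x) - x \<in> mat_range B"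
  shows "coker B \<cong> coker D"
proof -
  let ?G = "monoid_vec TYPE(int) n" and ?H = "monoid_vec TYPE(int) m"
  let ?h = "\<lambda>x. mat_range D #>\<^bsub>?H\<^esub> (P *\<^sub>v x)"
  interpret G: comm_group ?G by (rule comm_group_vec)
  interpret H: comm_group ?H by (rule comm_group_vec)
  interpret N: normal "mat_range D" ?H by (rule normal_mat_range[OF D])
  interpret C: comm_group "coker D" by (rule comm_group_coker)
  have P_hom: "(*\<^sub>v) P \<in> hom ?G ?H"
    using P mult_add_distrib_mat_vec[OF P] by (auto simp: hom_def monoid_vec_simps)
  have hom: "?h \<in> hom ?G (coker D)"
    using Group.hom_compose[OF P_hom N.r_coset_hom_Mod] by (simp add: coker_eq[OF D] o_def)
  have eq: "mat_range D #>\<^bsub>?H\<^esub> a = mat_range D #>\<^bsub>?H\<^esub> b"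
    if "a \<in> carrier_vec m" "b \<in> carrier_vec m" "a - b \<in> mat_range D" for a b
  proof -
    have "a = (a - b) \<otimes>\<^bsub>?H\<^esub> b" using that by (auto simp: monoid_vec_simps)
    then have "a \<in> mat_range D #>\<^bsub>?H\<^esub> b" using that(3) unfolding r_coset_def by blast
    from H.repr_independence[OF this _ N.subgroup_axioms] that(2) show ?thesis
      by (simp add: monoid_vec_simps)
  qed
  have surj: "?h ` carrier ?G = carrier (coker D)"
  proof
    show "?h ` carrier ?G \<subseteq> carrier (coker D)" using hom by (auto simp: hom_def)
    show "carrier (coker D) \<subseteq> ?h ` carrier ?G"
    proof
      fix X assume "X \<in> carrier (coker D)"
      then obtain y where y: "y \<in> carrier_vec m" "X = mat_range D #>\<^bsub>?H\<^esub> y"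
        by (auto simp: coker_eq[OF D] FactGroup_def RCOSETS_def monoid_vec_simps)
      have "X = ?h (Q *\<^sub>v y)" unfolding y(2)
        by (rule eq[symmetric]) (use P Q PQ y in auto)
      then show "X \<in> ?h ` carrier ?G" using Q y by (auto simp: monoid_vec_simps)
    qed
  qed
  have "kernel ?G (coker D) ?h = {x \<in> carrier_vec n. P *\<^sub>v x \<in> mat_range D}"
  proof -
    have "(mat_range D #>\<^bsub>?H\<^esub> y = mat_range D) = (y \<in> mat_range D)" if "y \<in> carrier_vec m" for y
      using that N.subgroup_axioms H.coset_join1[of "mat_range D" y] H.coset_join2[of y "mat_range D"]
        N.subset by (auto simp: monoid_vec_simps)
    moreover have "P *\<^sub>v x \<in> carrier_vec m" if "x \<in> carrier_vec n" for x
      using P that by simp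
    ultimately have "(?h x = mat_range D) = (P *\<^sub>v x \<in> mat_range D)" if "x \<in> carrier_vec n" for x
      using that by blast
    then show ?thesis
      unfolding kernel_def coker_eq[OF D] FactGroup_def by (auto simp only: monoid_vec_simps monoid.simps partial_object.simps)
  qed
  also have "\<dots> = mat_range B"
  proof safe
    fix x assume x: "x \<in> carrier_vec n" "P *\<^sub>v x \<in> mat_range D"
    \<comment> \<open>Both terms lie in the range of \<open>B\<close>: the first by
      \<open>QD\<close>, as \<open>P\<close> sends \<open>x\<close> into the range of
      \<open>D\<close>, and the second by \<open>QP\<close>.\<close>
    have "x = Q *\<^sub>v (P *\<^sub>v x) - (Q *\<^sub>v (P *\<^sub>v x) - x)" using x P Q by auto
    then show "x \<in> mat_range B"
      using mat_range_diff[OF B QD[OF x(2)] QP[OF x(1)]] by simp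
  qed (use PB mat_range_carrier[OF B] in auto)
  finally have "kernel ?G (coker D) ?h = mat_range B" .
  moreover have "group_hom ?G (coker D) ?h"
    using hom by unfold_locales
  ultimately have "(\<lambda>X. the_elem (?h ` X)) \<in> iso (?G Mod mat_range B) (coker D)"
    using group_hom.FactGroup_iso_set[OF _ surj] by metis
  then show ?thesis unfolding coker_eq[OF B] by (rule is_isoI)
qed

section \<open>Reduction to unit vectors\<close>

lemma mult_mat_unit_vec:
  fixes A :: "int mat"
  shows "A \<in> carrier_mat m l \<Longrightarrow> c < l \<Longrightarrow> A *\<^sub>v unit_vec l c = col A c"
  by (rule eq_vecI) auto

text \<open>Preimages under \<open>B\<close> of the columns of \<open>N\<close>, taken as the
  columns of an integer matrix \<open>X\<close>, give \<open>N = B * X\<close>. Range membership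
  thus needs to be checked on unit vectors only.\<close>

lemma mat_range_unit_vecs:
  assumes B: "B \<in> carrier_mat m k" and N: "N \<in> carrier_mat m l"
    and unit: "\<And>c. c < l \<Longrightarrow> N *\<^sub>v unit_vec l c \<in> mat_range B"
    and y: "y \<in> carrier_vec l"
  shows "N *\<^sub>v y \<in> mat_range B"
proof -
  have "\<exists>v \<in> carrier_vec k. col N c = B *\<^sub>v v" if "c < l" for c
    using unit[OF that] that N by (metis B mat_rangeE mult_mat_unit_vec)
  then obtain v where v: "\<And>c. c < l \<Longrightarrow> v c \<in> carrier_vec k" "\<And>c. c < l \<Longrightarrow> col N c = B *\<^sub>v v c"
    by metis
  define X where "X = mat_of_cols k (map v [0..<l])"
  have X: "X \<in> carrier_mat k l" unfolding X_def using mat_of_cols_carrier(1)[of k "map v [0..<l]"] by simp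
  have "N = B * X"
  proof (rule mat_col_eqI)
    fix c assume "c < dim_col (B * X)"
    then have c: "c < l" using X by auto
    then have "col X c = v c" unfolding X_def using v(1) by (subst col_mat_of_cols) auto
    then show "col N c = col (B * X) c" using col_mult2[OF B X c] v(2)[OF c] by simp
  qed (use B N X in auto)
  then have "N *\<^sub>v y = B *\<^sub>v (X *\<^sub>v y)" using B X y by simp
  then show ?thesis using mat_rangeI[OF B, of "X *\<^sub>v y"] X y by auto
qed

section \<open>Cyclic shifts and the incidence matrix of the graph\<close>

definition shift_mat :: "nat \<Rightarrow> nat \<Rightarrow> int mat" where
  "shift_mat n p = mat n n (\<lambda>(k, l). if k = (l + p) mod n then 1 else 0)"

lemma shift_mat_carrier [simp]: "shift_mat n p \<in> carrier_mat n n"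
  by (simp add: shift_mat_def)

lemma shift_mat_unit:
  "l < n \<Longrightarrow> shift_mat n p *\<^sub>v unit_vec n l = unit_vec n ((l + p) mod n)"
  by (subst mult_mat_unit_vec[of _ n n]) (auto simp: shift_mat_def unit_vec_def)

lemma eq_mat_unit_vecI:
  fixes A B :: "int mat"
  assumes "A \<in> carrier_mat m l" "B \<in> carrier_mat m l"
    and "\<And>c. c < l \<Longrightarrow> A *\<^sub>v unit_vec l c = B *\<^sub>v unit_vec l c"
  shows "A = B"
  by (rule mat_col_eqI) (use assms in \<open>auto simp: mult_mat_unit_vec\<close>)

lemma shift_mat_mult: "shift_mat n p * shift_mat n q = shift_mat n (p + q)"
proof (rule eq_mat_unit_vecI[of _ n n])
  fix c assume c: "c < n"
  then have "shift_mat n p *\<^sub>v (shift_mat n q *\<^sub>v unit_vec n c)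
      = unit_vec n (((c + q) mod n + p) mod n)"
    by (subst shift_mat_unit shift_mat_unit; simp)+
  also have "((c + q) mod n + p) mod n = (c + (p + q)) mod n"
    by (metis add.assoc add.commute mod_add_left_eq)
  finally show "shift_mat n p * shift_mat n q *\<^sub>v unit_vec n c = shift_mat n (p + q) *\<^sub>v unit_vec n c"
    using c by (simp add: shift_mat_unit assoc_mult_mat_vec[of _ n n _ n])
qed (auto intro: mult_carrier_mat[OF shift_mat_carrier shift_mat_carrier])

lemma shift_mat_self: "shift_mat n n = 1\<^sub>m n"
  by (rule eq_matI) (auto simp: shift_mat_def)

text \<open>Rows are sources, while a matrix acts through its columns. An edge from \<open>k\<close>
  to \<open>k + p\<close> therefore shows up as a shift by \<open>-p\<close>, written
  \<open>n - p\<close> to stay in the natural numbers.\<close>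

lemma incidence_circ_graph:
  assumes "j \<le> n" "1 \<le> n"
  shows "incidence_mat [0..<n] (circ_graph n j) = shift_mat n (n - 1) + shift_mat n (n - j)"
proof (rule eq_matI)
  have shift: "(k + p) mod n = l \<longleftrightarrow> k = (l + (n - p)) mod n"
    if "k < n" "l < n" "p \<le> n" for k l p
  proof -
    have "((k + p) mod n + (n - p)) mod n = k" "((l + (n - p)) mod n + p) mod n = l"
      using that by (simp_all only: mod_add_left_eq) simp_all
    then show ?thesis by auto
  qed
  fix k l assume "k < dim_row (shift_mat n (n - 1) + shift_mat n (n - j))"
    "l < dim_col (shift_mat n (n - 1) + shift_mat n (n - j))"
  then have kl: "k < n" "l < n" by (auto simp: shift_mat_def)
  \<comment> \<open>At most one edge of each constructor fits. Since the constructors are distinct,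
    the union is disjoint, and parallel edges add up to 2.\<close>
  have "{a \<in> arcs (circ_graph n j). tail (circ_graph n j) a = k \<and> head (circ_graph n j) a = l}
     = (if (k + 1) mod n = l then {E k} else {}) \<union> (if (k + j) mod n = l then {F k} else {})"
    using kl by (fastforce simp: circ_graph_def split: edge.splits if_splits)
  also have "int (card \<dots>) = (if (k + 1) mod n = l then 1 else 0) + (if (k + j) mod n = l then 1 else 0)"
    by auto
  finally show "incidence_mat [0..<n] (circ_graph n j) $$ (k, l)
      = (shift_mat n (n - 1) + shift_mat n (n - j)) $$ (k, l)"
    using kl shift[of k l 1] shift[of k l j] assms
    by (simp add: incidence_mat_def shift_mat_def)
qed (auto simp: incidence_mat_def shift_mat_def)

section \<open>The orbit of the first unit vector under the companion matrix\<close>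

definition orbit :: "nat \<Rightarrow> nat \<Rightarrow> int vec" where
  "orbit j k = (((*\<^sub>v) (companion_M j)) ^^ k) (unit_vec j 0)"

lemma companion_carrier [simp]: "companion_M j \<in> carrier_mat j j"
  by (simp add: companion_M_def)

lemma companion_unit:
  "Suc c < j \<Longrightarrow> companion_M j *\<^sub>v unit_vec j c = unit_vec j (Suc c)"
  by (subst mult_mat_unit_vec[of _ j j]) (auto simp: companion_M_def unit_vec_def intro!: eq_vecI)

lemma companion_unit_last:
  "2 \<le> j \<Longrightarrow> companion_M j *\<^sub>v unit_vec j (j - 1) = unit_vec j (j - 1) + unit_vec j 0"
  by (subst mult_mat_unit_vec[of _ j j]) (auto simp: companion_M_def unit_vec_def)

lemma pow_mat_mult_vec:
  fixes A :: "int mat"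
  assumes A: "A \<in> carrier_mat m m" and "y \<in> carrier_vec m"
  shows "(A ^\<^sub>m k) *\<^sub>v y = ((*\<^sub>v) A ^^ k) y"
  using assms(2)
proof (induction k arbitrary: y)
  case (Suc k)
  \<comment> \<open>The matrix power puts its new factor on the right, so the induction hypothesis
    is needed at \<open>A *\<^sub>v y\<close>; hence \<open>y\<close> is arbitrary.\<close>
  have "(A ^\<^sub>m Suc k) *\<^sub>v y = (A ^\<^sub>m k) *\<^sub>v (A *\<^sub>v y)"
    using A Suc.prems by (simp add: assoc_mult_mat_vec[of _ m m _ m])
  then show ?case using Suc A by (simp add: funpow_swap1)
qed (use A in auto)

lemma funpow_mult_vec_carrier:
  fixes A :: "int mat"
  assumes A: "A \<in> carrier_mat m m" and "y \<in> carrier_vec m"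
  shows "((*\<^sub>v) A ^^ k) y \<in> carrier_vec m"
  by (induction k) (use assms in auto)

lemma orbit_carrier [simp]: "orbit j k \<in> carrier_vec j"
  unfolding orbit_def by (rule funpow_mult_vec_carrier) auto

lemma orbit_Suc: "orbit j (Suc k) = companion_M j *\<^sub>v orbit j k"
  by (simp add: orbit_def)

lemma orbit_unit: "c < j \<Longrightarrow> orbit j c = unit_vec j c"
  by (induction c) (auto simp: orbit_Suc companion_unit, simp add: orbit_def)

text \<open>The orbit starts with the unit vectors, so \<open>k = 0\<close> is the last column of
  the companion matrix; applying the matrix to both sides raises \<open>k\<close>. This is the
  relation \<open>x^j = x^(j-1) + 1\<close> evaluated along the orbit.\<close>

lemma orbit_rec:
  assumes "2 \<le> j"
  shows "orbit j (k + j) = orbit j (k + (j - 1)) + orbit j k"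
proof (induction k)
  case 0
  have "orbit j j = companion_M j *\<^sub>v orbit j (j - 1)"
    using orbit_Suc[of j "j - 1"] assms by simp
  then show ?case using assms by (simp add: orbit_unit companion_unit_last[simplified])
next
  case (Suc k)
  then show ?case
    using mult_add_distrib_mat_vec[OF companion_carrier orbit_carrier orbit_carrier]
    by (simp add: orbit_Suc)
qed

lemma pow_companion_minus_one:
  assumes y: "y \<in> carrier_vec j"
  shows "(companion_M j ^\<^sub>m n - 1\<^sub>m j) *\<^sub>v y = ((*\<^sub>v) (companion_M j) ^^ n) y - y"
  using y minus_mult_distrib_mat_vec[of "companion_M j ^\<^sub>m n" j j "1\<^sub>m j" y]
  by (simp add: pow_mat_mult_vec[of _ j])

text \<open>Advancing the index by \<open>n\<close> adds \<open>D\<close> times an orbit vector;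
  \<open>a div n\<close> such steps telescope.\<close>

lemma orbit_mod:
  fixes n j :: nat
  defines "D \<equiv> companion_M j ^\<^sub>m n - 1\<^sub>m j"
  shows "orbit j a - orbit j (a mod n) \<in> mat_range D"
proof -
  have D: "D \<in> carrier_mat j j" by (auto simp: D_def)
  have "orbit j (a + n * q) - orbit j a \<in> mat_range D" for a q
  proof (induction q)
    case 0
    then show ?case using mat_range_zero[OF D] by (simp add: minus_cancel_vec[OF orbit_carrier])
  next
    case (Suc q)
    let ?b = "a + n * q"
    have "D *\<^sub>v orbit j ?b = orbit j (n + ?b) - orbit j ?b"
      unfolding D_def by (simp only: pow_companion_minus_one[OF orbit_carrier])
        (simp add: orbit_def funpow_add)
    then have "orbit j (n + ?b) - orbit j ?b \<in> mat_range D"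
      using mat_rangeI[OF D, of "orbit j ?b"] by simp
    from mat_range_add[OF D this Suc]
    have "(orbit j (n + ?b) - orbit j ?b) + (orbit j ?b - orbit j a) \<in> mat_range D" .
    also have "(orbit j (n + ?b) - orbit j ?b) + (orbit j ?b - orbit j a) = orbit j (n + ?b) - orbit j a"
      using orbit_carrier by (intro eq_vecI) (auto simp: carrier_vecD[OF orbit_carrier])
    finally show ?case by (simp add: ac_simps)
  qed
  from this[of "a mod n" "a div n"] show ?thesis by simp
qed

section \<open>The maps \<open>P\<close> and \<open>Q\<close> between the cokernels\<close>

theorem theorem2p3:
  fixes n j :: nat
  assumes "j \<ge> 2" and "n \<ge> j"
  shows "coker (incidence_mat [0..<n] (circ_graph n j) - 1\<^sub>m n)
       \<cong> coker (companion_M j ^\<^sub>m n - 1\<^sub>m j)"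
proof -
  define M where "M = companion_M j"
  define B where "B = shift_mat n (n - 1) + shift_mat n (n - j) - 1\<^sub>m n"
  define D where "D = companion_M j ^\<^sub>m n - 1\<^sub>m j"
  define P where "P = mat_of_cols j (map (orbit j) [0..<n])"
  define Q :: "int mat" where "Q = mat n j (\<lambda>(k, c). if k = c then 1 else 0)"
  have M: "M \<in> carrier_mat j j" and B: "B \<in> carrier_mat n n" and D: "D \<in> carrier_mat j j"
    and P: "P \<in> carrier_mat j n" and Q: "Q \<in> carrier_mat n j"
    by (auto simp: M_def B_def D_def P_def Q_def)
  have S: "shift_mat n p *\<^sub>v x \<in> carrier_vec n" if "x \<in> carrier_vec n" for p x
    using that by (rule mult_mat_vec_carrier[OF shift_mat_carrier])
  have P_unit: "P *\<^sub>v unit_vec n l = orbit j l" if "l < n" for l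
    using mult_mat_unit_vec[OF P that] that by (simp add: P_def)
  have Q_unit: "Q *\<^sub>v unit_vec j c = unit_vec n c" if "c < j" for c
    using that assms by (subst mult_mat_unit_vec[OF Q]) (auto simp: Q_def unit_vec_def)
  have B_unit: "B *\<^sub>v unit_vec n l
      = unit_vec n ((l + (n - 1)) mod n) + unit_vec n ((l + (n - j)) mod n) - unit_vec n l"
    if "l < n" for l
    unfolding B_def using that
    by (simp add: minus_mult_distrib_mat_vec[of _ n n] add_mult_distrib_mat_vec[of _ n n]
        shift_mat_unit)

  have PB: "P *\<^sub>v x \<in> mat_range D" if x: "x \<in> mat_range B" for x
  proof -
    have "(P * B) *\<^sub>v y \<in> mat_range D" if "y \<in> carrier_vec n" for y
    proof (rule mat_range_unit_vecs[OF D _ _ that])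
      show "P * B \<in> carrier_mat j n" using P B by simp
      fix l assume l: "l < n"
      let ?a = "l + (n - 1)" and ?b = "l + (n - j)"
      \<comment> \<open>Lifting \<open>l\<close> to \<open>l + n\<close> keeps the indices
        \<open>l - 1\<close> and \<open>l - j\<close> nonnegative, so the recurrence can be applied
        before reduction modulo \<open>n\<close>.\<close>
      have "?a = ?b + (j - 1)" "l + n = ?b + j" using assms by auto
      then have rec: "orbit j (l + n) = orbit j ?a + orbit j ?b"
        using orbit_rec[of j ?b] assms by metis
      have mods: "?a mod n < n" "?b mod n < n" using l by auto
      have "(P * B) *\<^sub>v unit_vec n l = orbit j (?a mod n) + orbit j (?b mod n) - orbit j l"
        using mods l P B by (simp add: assoc_mult_mat_vec[OF P B] B_unit P_unit
          mult_minus_distrib_mat_vec[OF P] mult_add_distrib_mat_vec[OF P])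
      \<comment> \<open>By \<open>rec\<close> the unreduced terms cancel. What remains are three
        errors of reducing an index modulo \<open>n\<close>, each covered by
        \<open>orbit_mod\<close>.\<close>
      also have "\<dots> = (orbit j (l + n) - orbit j l) - (orbit j ?a - orbit j (?a mod n))
           - (orbit j ?b - orbit j (?b mod n))"
        unfolding rec by (rule eq_vecI) (auto simp: carrier_vecD[OF orbit_carrier])
      also have "\<dots> \<in> mat_range D"
        using mat_range_diff[OF D mat_range_diff[OF D]]
          orbit_mod[of j "l + n" n] orbit_mod[of j ?a n] orbit_mod[of j ?b n] l
        unfolding D_def[symmetric] by simp
      finally show "(P * B) *\<^sub>v unit_vec n l \<in> mat_range D" .
    qed
    then show ?thesis using x P B by (auto elim!: mat_rangeE[OF _ B])
  qed

  \<comment> \<open>\<open>B\<close> is a combination of cyclic shifts, so it commutes with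
    \<open>shift_mat n 1\<close>, and its range is stable under that shift.\<close>
  have SB: "shift_mat n 1 *\<^sub>v x \<in> mat_range B" if "x \<in> mat_range B" for x
  proof -
    have "shift_mat n 1 * B = B * shift_mat n 1"
      by (simp add: B_def mult_minus_distrib_mat[where nr = n and n = n and nc = n]
          mult_add_distrib_mat[where nr = n and n = n and nc = n]
          minus_mult_distrib_mat[where nr = n and n = n and nc = n]
          add_mult_distrib_mat[where nr = n and n = n and nc = n] shift_mat_mult
          left_mult_one_mat[where nr = n and nc = n] right_mult_one_mat[where nr = n and nc = n])
    then have "shift_mat n 1 *\<^sub>v (B *\<^sub>v y) = B *\<^sub>v (shift_mat n 1 *\<^sub>v y)" if "y \<in> carrier_vec n" for y
      using that B by (metis assoc_mult_mat_vec shift_mat_carrier)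
    with that show ?thesis using S by (auto elim!: mat_rangeE[OF _ B] intro!: mat_rangeI[OF B])
  qed

  \<comment> \<open>The intertwining is exact on all unit vectors but the last; there the defect is
    a column of \<open>B\<close>.\<close>
  have QM: "Q *\<^sub>v (M *\<^sub>v y) - shift_mat n 1 *\<^sub>v (Q *\<^sub>v y) \<in> mat_range B" if y: "y \<in> carrier_vec j" for y
  proof -
    have N: "(Q * M - shift_mat n 1 * Q) *\<^sub>v z = Q *\<^sub>v (M *\<^sub>v z) - shift_mat n 1 *\<^sub>v (Q *\<^sub>v z)"
      if "z \<in> carrier_vec j" for z
      using that M Q by (simp add: minus_mult_distrib_mat_vec[of _ n j] assoc_mult_mat_vec[of _ n n _ j]
          assoc_mult_mat_vec[OF Q M] mult_carrier_mat[OF Q M] mult_carrier_mat[OF shift_mat_carrier Q])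
    have "(Q * M - shift_mat n 1 * Q) *\<^sub>v y \<in> mat_range B"
    proof (rule mat_range_unit_vecs[OF B _ _ y])
      show "Q * M - shift_mat n 1 * Q \<in> carrier_mat n j"
        by (rule minus_carrier_mat[OF mult_carrier_mat[OF shift_mat_carrier Q]])
      fix c assume c: "c < j"
      show "(Q * M - shift_mat n 1 * Q) *\<^sub>v unit_vec j c \<in> mat_range B"
      proof (cases "Suc c < j")
        case True
        then have "(Q * M - shift_mat n 1 * Q) *\<^sub>v unit_vec j c = 0\<^sub>v n"
          unfolding N[OF unit_vec_carrier]
          using assms by (simp add: M_def companion_unit Q_unit shift_mat_unit)
        then show ?thesis using mat_range_zero[OF B] by simp
      next
        case False
        then have cj: "c = j - 1" using c by simp
        have "(Q * M - shift_mat n 1 * Q) *\<^sub>v unit_vec j c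
            = unit_vec n (j - 1) + unit_vec n 0 - unit_vec n (j mod n)"
          unfolding N[OF unit_vec_carrier]
          using assms by (simp add: M_def cj companion_unit_last[simplified] Q_unit shift_mat_unit
            mult_add_distrib_mat_vec[OF Q])
        \<comment> \<open>The column of index \<open>j\<close>, with \<open>j - 1\<close> and
          \<open>0\<close> as its two predecessors. The \<open>mod\<close> matters only for
          \<open>n = j\<close>, where the index wraps to \<open>0\<close>.\<close>
        also have "\<dots> = B *\<^sub>v unit_vec n (j mod n)"
        proof -
          have "j + (n - 1) = (j - 1) + n" using assms by simp
          then have "(j mod n + (n - 1)) mod n = (j - 1) mod n"
            by (simp only: mod_add_left_eq mod_add_self2)
          then have "(j mod n + (n - 1)) mod n = j - 1" using assms by simp
          moreover have "(j mod n + (n - j)) mod n = 0"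
            using assms by (simp only: mod_add_left_eq) simp
          moreover have "j mod n < n" using assms by simp
          ultimately show ?thesis by (simp only: B_unit)
        qed
        also have "\<dots> \<in> mat_range B" by (rule mat_rangeI[OF B]) simp
        finally show ?thesis .
      qed
    qed
    then show ?thesis using N[OF y] by simp
  qed

  have Qpow: "Q *\<^sub>v ((*\<^sub>v) M ^^ k) y - shift_mat n k *\<^sub>v (Q *\<^sub>v y) \<in> mat_range B"
    if y: "y \<in> carrier_vec j" for k y
  proof (induction k)
    case 0
    have "shift_mat n 0 = 1\<^sub>m n" by (rule eq_matI) (auto simp: shift_mat_def)
    then show ?case using y mat_range_zero[OF B] mult_mat_vec_carrier[OF Q y] by simp
  next
    case (Suc k)
    define z where "z = ((*\<^sub>v) M ^^ k) y"
    define u where "u = shift_mat n k *\<^sub>v (Q *\<^sub>v y)"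
    have zu: "z \<in> carrier_vec j" "u \<in> carrier_vec n"
      using y Q S funpow_mult_vec_carrier[OF M y] by (auto simp: z_def u_def)
    have "shift_mat n (Suc k) *\<^sub>v (Q *\<^sub>v y) = shift_mat n 1 *\<^sub>v u"
      using y Q shift_mat_mult[of n 1 k] assoc_mult_mat_vec[of "shift_mat n 1" n n "shift_mat n k" n "Q *\<^sub>v y"]
      by (simp add: u_def)
    \<comment> \<open>The new defect is the one-step defect at \<open>z\<close> plus the shift of
      the old defect \<open>Q *\<^sub>v z - u\<close>; \<open>QM\<close> and \<open>SB\<close>
      handle them respectively.\<close>
    moreover have "Q *\<^sub>v (M *\<^sub>v z) - shift_mat n 1 *\<^sub>v u
       = (Q *\<^sub>v (M *\<^sub>v z) - shift_mat n 1 *\<^sub>v (Q *\<^sub>v z)) + shift_mat n 1 *\<^sub>v (Q *\<^sub>v z - u)"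
      using zu Q M S by (subst mult_minus_distrib_mat_vec[of _ n n]) auto
    moreover have "\<dots> \<in> mat_range B"
      using QM[OF zu(1)] SB Suc by (intro mat_range_add[OF B]) (auto simp: z_def u_def)
    ultimately show ?case by (simp add: z_def)
  qed

  have QD: "Q *\<^sub>v y \<in> mat_range B" if y: "y \<in> mat_range D" for y
  proof -
    obtain z where z: "z \<in> carrier_vec j" "y = D *\<^sub>v z" using mat_rangeE[OF y D] .
    have "Q *\<^sub>v y = Q *\<^sub>v ((*\<^sub>v) M ^^ n) z - Q *\<^sub>v z"
      using z funpow_mult_vec_carrier[OF M z(1)]
      by (simp add: D_def M_def pow_companion_minus_one mult_minus_distrib_mat_vec[OF Q])
    \<comment> \<open>With \<open>k = n\<close> the shift is the identity, so the defect in
      \<open>Qpow\<close> is exactly \<open>Q *\<^sub>v (D *\<^sub>v z)\<close>.\<close>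
    then show ?thesis using Qpow[OF z(1), of n] Q z by (simp add: shift_mat_self)
  qed

  have PQ: "P *\<^sub>v (Q *\<^sub>v y) - y \<in> mat_range D" if y: "y \<in> carrier_vec j" for y
  proof -
    have "P * Q = 1\<^sub>m j"
      by (rule eq_mat_unit_vecI[of _ j j])
        (use P Q assms in \<open>auto simp: assoc_mult_mat_vec[of _ j n _ j] Q_unit P_unit orbit_unit\<close>)
    then have "P *\<^sub>v (Q *\<^sub>v y) = y" using P Q y by (metis assoc_mult_mat_vec one_mult_mat_vec)
    then show ?thesis using y mat_range_zero[OF D] by simp
  qed

  have QP: "Q *\<^sub>v (P *\<^sub>v x) - x \<in> mat_range B" if x: "x \<in> carrier_vec n" for x
  proof -
    have N: "(Q * P - 1\<^sub>m n) *\<^sub>v z = Q *\<^sub>v (P *\<^sub>v z) - z" if "z \<in> carrier_vec n" for z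
      using that P Q by (simp add: minus_mult_distrib_mat_vec[of _ n n] assoc_mult_mat_vec[OF Q P] mult_carrier_mat[OF Q P])
    have "(Q * P - 1\<^sub>m n) *\<^sub>v x \<in> mat_range B"
    proof (rule mat_range_unit_vecs[OF B _ _ x])
      show "Q * P - 1\<^sub>m n \<in> carrier_mat n n" by (rule minus_carrier_mat) simp
      fix l assume "l < n"
      \<comment> \<open>\<open>Qpow\<close> at the first unit vector with \<open>k = l\<close>: the
        orbit vector is \<open>P\<close> of unit vector \<open>l\<close>, and shifting unit vector
        \<open>0\<close> by \<open>l\<close> gives unit vector \<open>l\<close> itself.\<close>
      then show "(Q * P - 1\<^sub>m n) *\<^sub>v unit_vec n l \<in> mat_range B"
        using Qpow[of "unit_vec j 0" l] assms
        unfolding N[OF unit_vec_carrier] by (simp add: P_unit Q_unit shift_mat_unit orbit_def M_def)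
    qed
    then show ?thesis using N[OF x] by simp
  qed

  have "coker B \<cong> coker D" by (rule coker_iso[OF B D P Q PB QD PQ QP])
  then show ?thesis using assms by (simp add: B_def D_def incidence_circ_graph)
qed

end
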